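(* There exists an absolute constant $c>0$ such that for all integers $n\geq 3$ and $m\geq n$ there exist continuous MHR distributions $\mathcal D_1,\dots,\mathcal D_m$ on $[0,\infty)$ such that, when the processing times $t_{ij}$ ($i\in\{1,\dots,n\}$, $j\in\{1,\dots,m\}$) are independent with $t_{ij}\sim\mathcal D_j$ for every machine $i$, one has $0<\mathbb E[\mathrm{OPT}(\mathbf t)]<\infty$ and $$\frac{\mathbb E[\mathrm{VCG}(\mathbf t)]}{\mathbb E[\mathrm{OPT}(\mathbf t)]}\geq c\,\frac{\ln n}{\ln\ln n}.$$
   Context: There are $n$ machines and $m\ge n$ tasks; $t_{ij}\ge 0$ is the processing time of task $j$ on machine $i$, and $\mathbf t=(t_{ij})$. The VCG allocation assigns each task $j$ to a machine $i$ with $t_{ij}=\min_{i'}t_{i'j}$, ties (which have probability zero for continuous distributions) being broken uniformly at random. With $\alpha_{ij}\in\{0,1\}$ indicating whether VCG assigns task $j$ to machine $i$, $\mathrm{VCG}(\mathbf t)=\max_i\sum_{j=1}^m\alpha_{ij}t_{ij}$ is its makespan. $\mathrm{OPT}(\mathbf t)$ is the minimum, over all assignments $a:\{1,\dots,m\}\to\{1,\dots,n\}$ of tasks to machines, of the makespan $\max_i\sum_{j:a(j)=i}t_{ij}$. A continuous distribution with pdf $f$ and cdf $F$ is MHR (monotone hazard rate) if its hazard rate $h(x)=\frac{f(x)}{1-F(x)}$ is weakly increasing (on the set where $F(x)<1$). *)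

theory Defs
  imports "HOL-Probability.Probability"
begin

text \<open>Machines are \<open>{1..n}\<close>, tasks are \<open>{1..m}\<close>, and an instance is a function
  \<open>t\<close> whose value \<open>t (i, j)\<close> is the processing time of task \<open>j\<close> on machine \<open>i\<close>.
  An assignment \<open>a\<close> maps each task to a machine.\<close>

definition makespan :: "nat \<Rightarrow> nat \<Rightarrow> (nat \<times> nat \<Rightarrow> real) \<Rightarrow> (nat \<Rightarrow> nat) \<Rightarrow> real" where
  "makespan n m t a = Max ((\<lambda>i. \<Sum>j | j \<in> {1..m} \<and> a j = i. t (i, j)) ` {1..n})"

definition OPT :: "nat \<Rightarrow> nat \<Rightarrow> (nat \<times> nat \<Rightarrow> real) \<Rightarrow> real" where
  "OPT n m t = Min (makespan n m t ` ({1..m} \<rightarrow>\<^sub>E {1..n}))"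

definition fastest_machines :: "nat \<Rightarrow> (nat \<times> nat \<Rightarrow> real) \<Rightarrow> nat \<Rightarrow> nat set" where
  "fastest_machines n t j = {i \<in> {1..n}. t (i, j) = Min ((\<lambda>i'. t (i', j)) ` {1..n})}"

text \<open>Ties are broken uniformly at random and independently across tasks, so the VCG
  allocation on a fixed instance is a random assignment.\<close>

definition VCG_allocation :: "nat \<Rightarrow> nat \<Rightarrow> (nat \<times> nat \<Rightarrow> real) \<Rightarrow> (nat \<Rightarrow> nat) pmf" where
  "VCG_allocation n m t = Pi_pmf {1..m} undefined (\<lambda>j. pmf_of_set (fastest_machines n t j))"

text \<open>The pdf is only determined up to null sets; the hazard rate condition is required of
  some version of it.\<close>

definition MHR_distribution :: "real measure \<Rightarrow> bool" where
  "MHR_distribution D \<longleftrightarrow> prob_space D \<and>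
     (\<exists>f. f \<in> borel_measurable borel \<and> (\<forall>x. 0 \<le> f x) \<and>
          D = density lborel (\<lambda>x. ennreal (f x)) \<and>
          mono_on {x. cdf D x < 1} (\<lambda>x. f x / (1 - cdf D x)))"

text \<open>Joint law of independent processing times with \<open>t (i, j)\<close> distributed as \<open>D j\<close>
  for every machine \<open>i\<close>.\<close>

definition instance_law :: "nat \<Rightarrow> nat \<Rightarrow> (nat \<Rightarrow> real measure) \<Rightarrow> (nat \<times> nat \<Rightarrow> real) measure" where
  "instance_law n m D = (\<Pi>\<^sub>M (i, j) \<in> {1..n} \<times> {1..m}. D j)"

text \<open>Expectations of the (almost surely nonnegative) makespans, with values in \<open>[0, \<infinity>]\<close>.
  The one for VCG is also over the tie-breaking.\<close>

definition E_OPT :: "nat \<Rightarrow> nat \<Rightarrow> (nat \<Rightarrow> real measure) \<Rightarrow> ennreal" where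
  "E_OPT n m D = (\<integral>\<^sup>+ t. ennreal (OPT n m t) \<partial>instance_law n m D)"

definition E_VCG :: "nat \<Rightarrow> nat \<Rightarrow> (nat \<Rightarrow> real measure) \<Rightarrow> ennreal" where
  "E_VCG n m D =
     (\<integral>\<^sup>+ t. (\<integral>\<^sup>+ a. ennreal (makespan n m t a) \<partial>measure_pmf (VCG_allocation n m t))
        \<partial>instance_law n m D)"

end

theory Submission
  imports Defs
begin

text \<open>The first \<open>n\<close> tasks are uniform on \<open>[1, 2]\<close> and the others on \<open>[0, 1/m]\<close>, so that \<open>OPT\<close> lies
  between 1 and 3 almost surely. Since the machines are identically distributed, VCG allocates the
  tasks independently and uniformly, hence its makespan is at least the maximum load of \<open>n\<close> balls
  thrown into \<open>n\<close> bins. By the second moment method, that load is at least \<open>k\<close> with probability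
  at least 1/2 as long as \<open>3 k^k \<le> n\<close>, which admits \<open>k\<close> of order \<open>ln n / ln ln n\<close>.\<close>

subsection \<open>Balls into bins\<close>

text \<open>The default \<open>undefined\<close> is that of \<open>VCG_allocation\<close>, so that
  the two laws can be compared directly.\<close>

definition random_allocation :: "'a set \<Rightarrow> 'b set \<Rightarrow> ('a \<Rightarrow> 'b) pmf" where
  "random_allocation A B = Pi_pmf A undefined (\<lambda>_. pmf_of_set B)"

definition load :: "'a set \<Rightarrow> ('a \<Rightarrow> 'b) \<Rightarrow> 'b \<Rightarrow> nat" where
  "load A a i = card {x \<in> A. a x = i}"

lemma load_insert_upd:
  assumes "finite A" "x \<notin> A"
  shows "load (insert x A) (a(x := y)) i = (if y = i then Suc (load A a i) else load A a i)"
proof -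
  have "{z \<in> insert x A. (a(x := y)) z = i} =
          (if y = i then insert x {z \<in> A. a z = i} else {z \<in> A. a z = i})"
    using assms by auto
  then show ?thesis
    using assms by (simp add: load_def)
qed

text \<open>Independent uniform coordinates form a uniform point of the product set. In this form
  the averaged VCG allocation is recognised later.\<close>

lemma random_allocation_eq_pmf_of_set:
  assumes "finite A" "finite B" "B \<noteq> {}"
  shows "random_allocation A B = pmf_of_set (PiE_dflt A undefined (\<lambda>_. B))"
  unfolding random_allocation_def using assms by (intro Pi_pmf_of_set) auto

lemma set_random_allocation:
  assumes "finite A" "finite B" "B \<noteq> {}"
  shows "set_pmf (random_allocation A B) = PiE_dflt A undefined (\<lambda>_. B)"
  unfolding random_allocation_def using assms by (subst set_Pi_pmf) (auto simp: o_def)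

lemma finite_set_random_allocation:
  assumes "finite A" "finite B" "B \<noteq> {}"
  shows "finite (set_pmf (random_allocation A B))"
  using assms by (simp add: set_random_allocation finite_PiE_dflt)

lemma integrable_random_allocation:
  fixes h :: "('a \<Rightarrow> 'b) \<Rightarrow> real"
  assumes "finite A" "finite B" "B \<noteq> {}"
  shows "integrable (measure_pmf (random_allocation A B)) h"
  by (intro integrable_measure_pmf_finite finite_set_random_allocation assms)

text \<open>Conditioning on the bin \<open>y\<close> of the new ball \<open>x\<close>; this drives
  the inductions over the balls.\<close>

lemma expectation_random_allocation_insert:
  fixes h :: "('a \<Rightarrow> 'b) \<Rightarrow> real"
  assumes "finite A" "x \<notin> A" "finite B" "B \<noteq> {}"
  shows "measure_pmf.expectation (random_allocation (insert x A) B) h =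
    (\<Sum>y\<in>B. measure_pmf.expectation (random_allocation A B) (\<lambda>a. h (a(x := y)))) / card B"
proof -
  have "random_allocation (insert x A) B =
      pmf_of_set B \<bind> (\<lambda>y. map_pmf (\<lambda>a. a(x := y)) (random_allocation A B))"
    unfolding random_allocation_def using assms by (simp add: Pi_pmf_insert' map_pmf_def)
  then show ?thesis
    using assms finite_set_random_allocation[of A B]
    by (simp add: pmf_expectation_bind_pmf_of_set sum_divide_distrib divide_inverse mult.commute
        sum_distrib_left)
qed

text \<open>The new ball raises the load of \<open>i\<close> for one choice of bin and leaves it
  unchanged for the other \<open>card B - 1\<close> choices.\<close>

lemma expectation_load_insert:
  fixes F :: "nat \<Rightarrow> real"
  assumes "finite A" "x \<notin> A" "finite B" "i \<in> B"
  shows "measure_pmf.expectation (random_allocation (insert x A) B)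
           (\<lambda>a. F (load (insert x A) a i)) =
    (measure_pmf.expectation (random_allocation A B) (\<lambda>a. F (Suc (load A a i))) +
     (real (card B) - 1) * measure_pmf.expectation (random_allocation A B) (\<lambda>a. F (load A a i)))
      / card B"
proof -
  have B: "B \<noteq> {}" using assms by auto
  have *: "real (card (B - {i})) = real (card B) - 1"
    using assms B by (subst card_Diff_singleton) (auto simp: of_nat_diff Suc_leI card_gt_0_iff)
  have "(\<Sum>y\<in>B - {i}. measure_pmf.expectation (random_allocation A B)
      (\<lambda>a. F (if y = i then Suc (load A a i) else load A a i))) =
    (\<Sum>y\<in>B - {i}. measure_pmf.expectation (random_allocation A B) (\<lambda>a. F (load A a i)))"
    by (intro sum.cong) auto
  then show ?thesis
    using assms B *
    by (simp add: expectation_random_allocation_insert load_insert_upd sum.remove[of B i])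
qed

text \<open>Negative association of the loads of two bins: adding one ball makes the two sides differ by
  the product of the two increments divided by \<open>card B\<^sup>2\<close>.\<close>

lemma expectation_mono_loads_le:
  fixes F G :: "nat \<Rightarrow> real"
  assumes "finite A" "finite B" "i \<in> B" "j \<in> B" "i \<noteq> j" "mono F" "mono G"
  shows "measure_pmf.expectation (random_allocation A B) (\<lambda>a. F (load A a i) * G (load A a j)) \<le>
    measure_pmf.expectation (random_allocation A B) (\<lambda>a. F (load A a i)) *
    measure_pmf.expectation (random_allocation A B) (\<lambda>a. G (load A a j))"
  using assms(1,6,7)
proof (induction A arbitrary: F G rule: finite_induct)
  case empty
  then show ?case by (simp add: random_allocation_def)
next
  case (insert x A)
  let ?E = "measure_pmf.expectation (random_allocation A B)"
  define n where "n = real (card B)"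
  define f f' g g' where "f = ?E (\<lambda>a. F (load A a i))" and "f' = ?E (\<lambda>a. F (Suc (load A a i)))"
    and "g = ?E (\<lambda>a. G (load A a j))" and "g' = ?E (\<lambda>a. G (Suc (load A a j)))"
  have B: "B \<noteq> {}" using assms by auto
  have "card {i, j} \<le> card B"
    using assms by (intro card_mono) auto
  then have n2: "n \<ge> 2" using assms by (simp add: n_def)
  have c2: "real (card (B - {i} - {j})) = n - 2"
  proof -
    have "B - {i} - {j} = B - {i, j}" by auto
    moreover have "card (B - {i, j}) = card B - card {i, j}"
      using assms by (intro card_Diff_subset) auto
    ultimately show ?thesis using n2 assms by (simp add: n_def of_nat_diff)
  qed
  \<comment> \<open>Shifting keeps \<open>F\<close> and \<open>G\<close> monotone, so the induction
    hypothesis, general in both, covers all three terms below.\<close>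
  have S: "mono (\<lambda>k. F (Suc k))" "mono (\<lambda>k. G (Suc k))"
    using insert.prems by (auto simp: mono_def)
  \<comment> \<open>The new ball falls into \<open>i\<close>, into \<open>j\<close>, or into one of
    the \<open>n - 2\<close> bins that affect neither load.\<close>
  have "(\<Sum>y\<in>B - {i} - {j}. ?E (\<lambda>a. F (if y = i then Suc (load A a i) else load A a i) *
        G (if y = j then Suc (load A a j) else load A a j))) =
      (\<Sum>y\<in>B - {i} - {j}. ?E (\<lambda>a. F (load A a i) * G (load A a j)))"
    by (intro sum.cong) auto
  then have "measure_pmf.expectation (random_allocation (insert x A) B)
      (\<lambda>a. F (load (insert x A) a i) * G (load (insert x A) a j)) =
    (?E (\<lambda>a. F (Suc (load A a i)) * G (load A a j)) +
     ?E (\<lambda>a. F (load A a i) * G (Suc (load A a j))) +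
     (n - 2) * ?E (\<lambda>a. F (load A a i) * G (load A a j))) / n"
    using assms insert.hyps B c2
    by (simp add: expectation_random_allocation_insert load_insert_upd sum.remove[of B i]
        sum.remove[of "B - {i}" j] n_def)
  also have "\<dots> \<le> (f' * g + f * g' + (n - 2) * (f * g)) / n"
    unfolding f_def f'_def g_def g'_def using n2 S insert.prems
    by (intro divide_right_mono add_mono mult_left_mono insert.IH) auto
  also have "\<dots> \<le> ((f' + (n - 1) * f) / n) * ((g' + (n - 1) * g) / n)"
  proof -
    have "f \<le> f'" "g \<le> g'"
      unfolding f_def f'_def g_def g'_def using insert B assms
      by (auto intro!: integral_mono integrable_random_allocation elim: monoD)
    then have "0 \<le> (f' - f) * (g' - g)" by simp
    then have "(f' * g + f * g' + (n - 2) * (f * g)) * n \<le> (f' + (n - 1) * f) * (g' + (n - 1) * g)"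
      by (simp add: algebra_simps)
    then have "(f' * g + f * g' + (n - 2) * (f * g)) * n / (n * n) \<le>
        (f' + (n - 1) * f) * (g' + (n - 1) * g) / (n * n)"
      by (intro divide_right_mono) auto
    then show ?thesis using n2 by simp
  qed
  also have "\<dots> = measure_pmf.expectation (random_allocation (insert x A) B)
        (\<lambda>a. F (load (insert x A) a i)) *
      measure_pmf.expectation (random_allocation (insert x A) B)
        (\<lambda>a. G (load (insert x A) a j))"
    using assms insert.hyps by (simp add: expectation_load_insert f_def f'_def g_def g'_def n_def)
  finally show ?case .
qed

text \<open>The load counts successes of independent trials, one per ball, each hitting bin
  \<open>i\<close> with probability \<open>1 / card B\<close>.\<close>

lemma map_load_random_allocation:
  assumes "finite A" "finite B" "i \<in> B"
  shows "map_pmf (\<lambda>a. load A a i) (random_allocation A B) = binomial_pmf (card A) (1 / card B)"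
proof -
  have n: "1 \<le> real (card B)"
    using assms card_gt_0_iff[of B] by auto
  have "map_pmf (\<lambda>y. y = i) (pmf_of_set B) = bernoulli_pmf (1 / card B)"
  proof (rule pmf_eqI)
    fix b
    have T: "pmf (map_pmf (\<lambda>y. y = i) (pmf_of_set B)) True = 1 / card B"
      unfolding pmf_map using assms by (subst measure_pmf_of_set) (auto simp: vimage_def)
    have "pmf (map_pmf (\<lambda>y. y = i) (pmf_of_set B)) False = 1 - 1 / card B"
      using T pmf_False_conv_True by metis
    then show "pmf (map_pmf (\<lambda>y. y = i) (pmf_of_set B)) b = pmf (bernoulli_pmf (1 / card B)) b"
      using T n by (cases b) auto
  qed
  \<comment> \<open>The default \<open>undefined = i\<close> is the image of
    \<open>undefined\<close> under the test for bin \<open>i\<close>, as pushing a map through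
    \<open>Pi_pmf\<close> requires.\<close>
  then have "binomial_pmf (card A) (1 / card B) =
      map_pmf (\<lambda>f. card {x\<in>A. f x})
        (Pi_pmf A (undefined = i) (\<lambda>_. map_pmf (\<lambda>y. y = i) (pmf_of_set B)))"
    using n assms by (subst binomial_pmf_altdef'[where A = A and dflt = "undefined = i"]) auto
  also have "\<dots> = map_pmf (\<lambda>a. load A a i) (random_allocation A B)"
    using assms by (subst Pi_pmf_map[where dflt = undefined])
      (auto simp: map_pmf_comp random_allocation_def load_def o_def)
  finally show ?thesis ..
qed

text \<open>The single binomial term for load exactly \<open>k\<close> suffices: the binomial
  coefficient is at least \<open>(n/k)^k\<close>, and the misses contribute at least 1/3.\<close>

lemma prob_load_ge:
  assumes "finite A" "finite B" "i \<in> B" "card A = n" "card B = n" "1 \<le> k" "k \<le> n" "2 \<le> n"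
  shows "1 / (3 * real k ^ k) \<le> measure_pmf.prob (random_allocation A B) {a. k \<le> load A a i}"
proof -
  define p where "p = 1 / real n"
  have p: "0 \<le> p" "p \<le> 1" using assms by (auto simp: p_def)
  have "1 / 3 \<le> (1 - p) ^ (n - 1)"
  proof -
    \<comment> \<open>With q = n - 1, 1 - 1/n is the inverse of 1 + 1/q, and (1 + 1/q)^q is at most
      e, hence at most 3.\<close>
    define q where "q = real (n - 1)"
    have q: "q \<ge> 1" "real n = q + 1" using assms by (auto simp: q_def)
    have "(1 + 1 / q) ^ (n - 1) \<le> exp (1 / q) ^ (n - 1)"
      using q by (intro power_mono) (auto simp: add.commute)
    also have "\<dots> = exp 1"
      using q by (simp add: q_def flip: exp_of_nat_mult)
    also have "\<dots> \<le> 3" by (rule exp_le)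
    finally have "(1 + 1 / q) ^ (n - 1) \<le> 3" .
    moreover have "1 - p = 1 / (1 + 1 / q)"
      using q by (simp add: p_def field_simps)
    moreover have "0 < (1 + 1 / q) ^ (n - 1)"
      using q by (intro zero_less_power) (simp add: add_pos_pos)
    ultimately show ?thesis
      by (simp add: power_one_over frac_le del: One_nat_def)
  qed
  also have "\<dots> \<le> (1 - p) ^ (n - k)"
    using p assms by (intro power_decreasing) auto
  finally have e: "1 / 3 \<le> (1 - p) ^ (n - k)" .
  have "1 / (3 * real k ^ k) = (real n / real k) ^ k * p ^ k * (1 / 3)"
    using assms by (simp add: p_def power_divide field_simps)
  also have "\<dots> \<le> real (n choose k) * p ^ k * (1 - p) ^ (n - k)"
    using e p assms by (intro mult_mono binomial_ge_n_over_k_pow_k) auto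
  also have "\<dots> = pmf (binomial_pmf (card A) (1 / card B)) k"
    using p assms by (simp add: p_def)
  also have "\<dots> = measure_pmf.prob (random_allocation A B) {a. load A a i = k}"
    using assms by (subst map_load_random_allocation[symmetric])
      (auto simp: pmf_map vimage_def)
  also have "\<dots> \<le> measure_pmf.prob (random_allocation A B) {a. k \<le> load A a i}"
    by (intro measure_pmf.finite_measure_mono) auto
  finally show ?thesis .
qed

text \<open>Second moment method for the number \<open>X\<close> of bins of load at least \<open>k\<close>: with \<open>\<mu> = E[X]\<close> and
  \<open>E[X\<^sup>2] \<le> \<mu> + \<mu>\<^sup>2\<close>, integrate \<open>2sX - s\<^sup>2X\<^sup>2 \<le> 1\<^bsub>X>0\<^esub>\<close> for \<open>s = 1 / (1 + \<mu>)\<close>.\<close>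

lemma prob_max_load_ge:
  fixes A :: "'a set" and B :: "'b set"
  assumes A: "finite A" and B: "finite B" and n: "card A = n" "card B = n" "2 \<le> n"
    and k: "1 \<le> k" "3 * k ^ k \<le> n"
  shows "1 / 2 \<le> measure_pmf.prob (random_allocation A B) {a. \<exists>i\<in>B. k \<le> load A a i}"
proof -
  let ?M = "random_allocation A B"
  let ?E = "measure_pmf.expectation ?M"
  define Y where "Y i a = (of_bool (k \<le> load A a i) :: real)" for i :: 'b and a :: "'a \<Rightarrow> 'b"
  define X where "X a = (\<Sum>i\<in>B. Y i a)" for a
  define p where "p i = ?E (Y i)" for i
  define \<mu> where "\<mu> = (\<Sum>i\<in>B. p i)"
  define s where "s = 1 / (1 + \<mu>)"
  have ne: "B \<noteq> {}" using n by auto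
  note [simp] = integrable_random_allocation[OF A B ne]
  have "k \<le> k ^ k" using k by (intro self_le_power) auto
  then have kn: "k \<le> n" using k by linarith
  have p_prob: "p i = measure_pmf.prob ?M {a. k \<le> load A a i}" for i
  proof -
    have "Y i = indicator {a. k \<le> load A a i}"
      by (auto simp: Y_def fun_eq_iff indicator_def)
    then show ?thesis by (simp add: p_def)
  qed
  \<comment> \<open>Here 3 k^k \<le> n enters: n bins, each with probability at least 1/(3 k^k),
    make the expected count at least 1.\<close>
  have "1 \<le> (\<Sum>i\<in>B. 1 / (3 * real k ^ k))"
  proof -
    have "real (3 * k ^ k) \<le> real n" using k by (simp only: of_nat_le_iff)
    then show ?thesis using n k by (simp add: field_simps)
  qed
  also have "\<dots> \<le> \<mu>"
    unfolding \<mu>_def p_prob using A B n k kn by (intro sum_mono prob_load_ge) auto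
  finally have \<mu>: "1 \<le> \<mu>" .
  have EX: "?E X = \<mu>"
    unfolding X_def \<mu>_def p_def by (subst Bochner_Integration.integral_sum) auto
  have "?E (\<lambda>a. (X a)\<^sup>2) = (\<Sum>i\<in>B. \<Sum>j\<in>B. ?E (\<lambda>a. Y i a * Y j a))"
    unfolding X_def power2_eq_square sum_product
    by (simp add: Bochner_Integration.integral_sum)
  \<comment> \<open>Diagonal terms collapse because indicators are idempotent; off the diagonal,
    negative association bounds the joint probability by the product.\<close>
  also have "\<dots> \<le> (\<Sum>i\<in>B. \<Sum>j\<in>B. (if i = j then p i else 0) + p i * p j)"
  proof (intro sum_mono)
    fix i j assume ij: "i \<in> B" "j \<in> B"
    show "?E (\<lambda>a. Y i a * Y j a) \<le> (if i = j then p i else 0) + p i * p j"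
    proof (cases "i = j")
      case True
      have "(\<lambda>a. Y i a * Y i a) = Y i" by (simp add: Y_def fun_eq_iff)
      then show ?thesis using True by (simp flip: p_def)
    next
      case False
      then show ?thesis
        using expectation_mono_loads_le[OF A B ij False,
            of "\<lambda>l. of_bool (k \<le> l)" "\<lambda>l. of_bool (k \<le> l)"]
        by (simp add: Y_def[abs_def] p_def mono_def)
    qed
  qed
  also have "\<dots> = \<mu> + \<mu>\<^sup>2"
    using B by (simp add: sum.distrib \<mu>_def power2_eq_square sum_product)
  finally have EX2: "?E (\<lambda>a. (X a)\<^sup>2) \<le> \<mu> + \<mu>\<^sup>2" .
  have "1 / 2 \<le> \<mu> * s" using \<mu> by (simp add: s_def field_simps)
  \<comment> \<open>This \<open>s\<close> maximises the right-hand side as a quadratic in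
    \<open>s\<close>.\<close>
  also have "\<mu> * s = 2 * s * \<mu> - s\<^sup>2 * (\<mu> + \<mu>\<^sup>2)"
    using \<mu> by (simp add: s_def power2_eq_square divide_simps) (simp add: algebra_simps)
  also have "\<dots> \<le> 2 * s * ?E X - s\<^sup>2 * ?E (\<lambda>a. (X a)\<^sup>2)"
    using EX2 by (simp add: EX mult_left_mono)
  also have "\<dots> = ?E (\<lambda>a. 2 * s * X a - s\<^sup>2 * (X a)\<^sup>2)"
    by simp
  also have "\<dots> \<le> ?E (indicator {a. \<exists>i\<in>B. k \<le> load A a i})"
  proof (intro integral_mono)
    fix a
    show "2 * s * X a - s\<^sup>2 * (X a)\<^sup>2 \<le> indicator {a. \<exists>i\<in>B. k \<le> load A a i} a"
    proof (cases "\<exists>i\<in>B. k \<le> load A a i")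
      case True
      \<comment> \<open>The left-hand side of the goal equals 1 - (1 - sX)^2.\<close>
      have "0 \<le> (1 - s * X a)\<^sup>2" by simp
      then show ?thesis using True by (simp add: power2_eq_square algebra_simps)
    next
      case False
      then have "X a = 0" by (auto simp: X_def Y_def)
      then show ?thesis using False by simp
    qed
  qed auto
  finally show ?thesis by simp
qed

subsection \<open>The law of the VCG allocation\<close>

text \<open>Pairwise comparisons instead of \<open>Min\<close> suit both the symmetry and the
  measurability arguments.\<close>

lemma fastest_machines_altdef:
  "fastest_machines n t j = {i \<in> {1..n}. \<forall>i'\<in>{1..n}. t (i, j) \<le> t (i', j)}"
proof -
  have "t (i, j) = Min ((\<lambda>i'. t (i', j)) ` {1..n}) \<longleftrightarrow> (\<forall>i'\<in>{1..n}. t (i, j) \<le> t (i', j))"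
    if "i \<in> {1..n}" for i
    using that by (subst eq_Min_iff) auto
  then show ?thesis by (auto simp: fastest_machines_def)
qed

lemma finite_fastest_machines [simp]: "finite (fastest_machines n t j)"
  by (simp add: fastest_machines_def)

lemma fastest_machines_nonempty:
  assumes "1 \<le> n"
  shows "fastest_machines n t j \<noteq> {}"
proof -
  have "Min ((\<lambda>i'. t (i', j)) ` {1..n}) \<in> (\<lambda>i'. t (i', j)) ` {1..n}"
    using assms by (intro Min_in) auto
  then show ?thesis by (auto simp: fastest_machines_def)
qed

lemma fastest_machines_permute:
  assumes "\<pi> permutes {1..n}" and "\<And>i. i \<in> {1..n} \<Longrightarrow> t' (i, j) = t (\<pi> i, j)"
  shows "fastest_machines n t' j = \<pi> -` fastest_machines n t j"
proof -
  have *: "(\<forall>i'\<in>{1..n}. t (\<pi> i, j) \<le> t (\<pi> i', j)) \<longleftrightarrow> (\<forall>i'\<in>{1..n}. t (\<pi> i, j) \<le> t (i', j))" for i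
    using permutes_image[OF assms(1)] by (metis (no_types, lifting) image_iff)
  have "i \<in> fastest_machines n t' j \<longleftrightarrow> \<pi> i \<in> fastest_machines n t j" for i
    using assms permutes_in_image[OF assms(1), of i]
    by (simp add: fastest_machines_altdef * cong: conj_cong del: atLeastAtMost_iff One_nat_def)
  then show ?thesis by auto
qed

text \<open>Tasks are allocated independently, so the mass factorises. Measurability in
  \<open>t\<close> and the symmetry between allocations are both read off this product.\<close>

lemma pmf_VCG_allocation:
  assumes "1 \<le> n" "a \<in> PiE_dflt {1..m} undefined (\<lambda>_. {1..n})"
  shows "pmf (VCG_allocation n m t) a =
    (\<Prod>j\<in>{1..m}. of_bool (a j \<in> fastest_machines n t j) / card (fastest_machines n t j))"
  using assms fastest_machines_nonempty[OF assms(1)]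
  by (auto simp: VCG_allocation_def pmf_Pi PiE_dflt_def indicator_def intro!: prod.cong)

lemma set_VCG_allocation:
  assumes "1 \<le> n"
  shows "set_pmf (VCG_allocation n m t) = PiE_dflt {1..m} undefined (fastest_machines n t)"
  using assms fastest_machines_nonempty[OF assms]
  unfolding VCG_allocation_def by (subst set_Pi_pmf) (auto simp: o_def)

lemma set_VCG_allocation_subset:
  assumes "1 \<le> n"
  shows "set_pmf (VCG_allocation n m t) \<subseteq> PiE_dflt {1..m} undefined (\<lambda>_. {1..n})"
  using assms by (auto simp: set_VCG_allocation PiE_dflt_def fastest_machines_def)

lemma prob_space_instance_law:
  assumes "\<And>j. prob_space (D j)"
  shows "prob_space (instance_law n m D)"
  unfolding instance_law_def using assms by (intro prob_space_PiM) auto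

text \<open>Being fastest is a finite conjunction of comparisons between coordinates, and the number
  of fastest machines is a sum of the corresponding indicators.\<close>

lemma measurable_pmf_VCG_allocation:
  assumes D: "\<And>j. sets (D j) = sets borel"
    and "1 \<le> n" "a \<in> PiE_dflt {1..m} undefined (\<lambda>_. {1..n})"
  shows "(\<lambda>t. pmf (VCG_allocation n m t) a) \<in> borel_measurable (instance_law n m D)"
proof -
  have t: "(\<lambda>t. t (i, j)) \<in> borel_measurable (instance_law n m D)"
    if "i \<in> {1..n}" "j \<in> {1..m}" for i j
  proof -
    have "(\<lambda>t. t (i, j)) \<in> measurable (instance_law n m D) (case (i, j) of (i, j) \<Rightarrow> D j)"
      unfolding instance_law_def using that by (intro measurable_component_singleton) auto
    then show ?thesis
      using D measurable_cong_sets[of "instance_law n m D" _ "D j" borel] by auto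
  qed
  have fast: "(\<lambda>t. of_bool (i \<in> fastest_machines n t j) :: real)
      \<in> borel_measurable (instance_law n m D)" if "j \<in> {1..m}" for i j
  proof (cases "i \<in> {1..n}")
    case True
    have "(\<lambda>t. of_bool (i \<in> fastest_machines n t j) :: real) =
        (\<lambda>t. \<Prod>i'\<in>{1..n}. if t (i, j) \<le> t (i', j) then 1 else 0)"
      using True by (auto simp: fastest_machines_altdef fun_eq_iff of_bool_def)
    also have "\<dots> \<in> borel_measurable (instance_law n m D)"
      using t[OF True that] t[OF _ that] by (intro borel_measurable_prod measurable_If) auto
    finally show ?thesis .
  next
    case False
    then have "(\<lambda>t. of_bool (i \<in> fastest_machines n t j) :: real) = (\<lambda>_. 0)"
      by (auto simp: fastest_machines_def fun_eq_iff)
    then show ?thesis by simp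
  qed
  have card: "real (card (fastest_machines n t j)) =
      (\<Sum>i\<in>{1..n}. of_bool (i \<in> fastest_machines n t j))" for t j
  proof -
    have "{1..n} \<inter> fastest_machines n t j = fastest_machines n t j"
      by (auto simp: fastest_machines_def)
    then show ?thesis by (simp add: of_bool_def sum.If_cases)
  qed
  show ?thesis
    unfolding pmf_VCG_allocation[OF assms(2,3)] card
    by (intro borel_measurable_prod borel_measurable_divide borel_measurable_sum fast)
qed

text \<open>The index set of the sum is finite and does not depend on \<open>t\<close>, so the sum
  can be exchanged with the integral over instances.\<close>

lemma emeasure_VCG_allocation:
  assumes "1 \<le> n"
  shows "emeasure (VCG_allocation n m t) S =
    (\<Sum>a\<in>PiE_dflt {1..m} undefined (\<lambda>_. {1..n}) \<inter> S. ennreal (pmf (VCG_allocation n m t) a))"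
proof -
  let ?A = "PiE_dflt {1..m} undefined (\<lambda>_. {1..n})"
  have "emeasure (VCG_allocation n m t) S = emeasure (VCG_allocation n m t) (?A \<inter> S)"
    using set_VCG_allocation_subset[OF assms, of m t]
    by (intro emeasure_eq_AE) (auto simp: AE_measure_pmf_iff)
  moreover have "finite (?A \<inter> S)"
    by (intro finite_Int disjI1 finite_PiE_dflt) auto
  ultimately show ?thesis by (simp add: emeasure_measure_pmf_finite)
qed

lemma measurable_emeasure_VCG_allocation:
  assumes "\<And>j. sets (D j) = sets borel" and "1 \<le> n"
  shows "(\<lambda>t. emeasure (VCG_allocation n m t) S) \<in> borel_measurable (instance_law n m D)"
  unfolding emeasure_VCG_allocation[OF assms(2)] using assms
  by (intro borel_measurable_sum measurable_compose[OF _ measurable_ennreal]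
      measurable_pmf_VCG_allocation) auto

text \<open>Swapping \<open>a j\<close> and \<open>b j\<close> in each column \<open>j\<close> preserves the law of the instance and exchanges
  the two allocations.\<close>

lemma nn_integral_pmf_VCG_allocation_eq:
  assumes D: "\<And>j. prob_space (D j)" "\<And>j. sets (D j) = sets borel"
    and n: "1 \<le> n"
    and a: "a \<in> PiE_dflt {1..m} undefined (\<lambda>_. {1..n})"
    and b: "b \<in> PiE_dflt {1..m} undefined (\<lambda>_. {1..n})"
  shows "(\<integral>\<^sup>+ t. ennreal (pmf (VCG_allocation n m t) a) \<partial>instance_law n m D) =
    (\<integral>\<^sup>+ t. ennreal (pmf (VCG_allocation n m t) b) \<partial>instance_law n m D)"
proof -
  define I where "I = {1..n} \<times> {1..m}"
  define \<pi> where "\<pi> j = Transposition.transpose (a j) (b j)" for j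
  define f where "f = (\<lambda>(i, j). (\<pi> j i, j))"
  have \<pi>: "\<pi> j permutes {1..n}" if "j \<in> {1..m}" for j
    unfolding \<pi>_def using that a b by (intro permutes_swap_id) (auto simp: PiE_dflt_def)
  have "f (f x) = x" for x
    by (cases x) (simp add: f_def \<pi>_def)
  then have "inj_on f I"
    by (metis inj_onI)
  moreover have "f x \<in> I" if "x \<in> I" for x
    using that permutes_in_image[OF \<pi>[of "snd x"], of "fst x"]
    by (simp add: I_def f_def case_prod_beta mem_Times_iff del: atLeastAtMost_iff)
  ultimately have f: "inj_on f I" "f \<in> I \<rightarrow> I" by auto
  define M where "M = (\<lambda>(i::nat, j). D j)"
  have Mf: "M (f x) = M x" for x by (cases x) (simp add: M_def f_def)
  have law: "instance_law n m D = PiM I M"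
    by (simp add: instance_law_def I_def M_def)
  \<comment> \<open>\<open>f\<close> moves entries only within a column, where all factors are the
    same \<open>D j\<close>, so reindexing preserves the product measure.\<close>
  have P: "distr (PiM I M) (PiM I M) (\<lambda>t. \<lambda>x\<in>I. t (f x)) = PiM I M"
    using distr_PiM_reindex[of I M f I] D f by (simp add: Mf) (auto simp: M_def split: prod.splits)
  have meas: "(\<lambda>t. \<lambda>x\<in>I. t (f x)) \<in> measurable (PiM I M) (PiM I M)"
  proof (intro measurable_restrict)
    fix x assume "x \<in> I"
    then have "f x \<in> I" using f by auto
    then show "(\<lambda>t. t (f x)) \<in> measurable (PiM I M) (M x)"
      using measurable_component_singleton[of "f x" I M] by (simp add: Mf)
  qed
  have swap: "pmf (VCG_allocation n m (\<lambda>x\<in>I. t (f x))) a = pmf (VCG_allocation n m t) b" for t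
  proof -
    have fast: "fastest_machines n (\<lambda>x\<in>I. t (f x)) j = \<pi> j -` fastest_machines n t j"
      if "j \<in> {1..m}" for j
      using that by (intro fastest_machines_permute \<pi>) (auto simp: I_def f_def)
    have "card (fastest_machines n (\<lambda>x\<in>I. t (f x)) j) = card (fastest_machines n t j)"
      if "j \<in> {1..m}" for j
      unfolding fast[OF that] using permutes_bij[OF \<pi>[OF that]]
      by (intro card_vimage_inj) (auto simp: bij_is_inj bij_is_surj)
    moreover have "a j \<in> fastest_machines n (\<lambda>x\<in>I. t (f x)) j \<longleftrightarrow> b j \<in> fastest_machines n t j"
      if "j \<in> {1..m}" for j
      unfolding fast[OF that] by (simp add: \<pi>_def)
    ultimately show ?thesis
      unfolding pmf_VCG_allocation[OF n a] pmf_VCG_allocation[OF n b] by (intro prod.cong) auto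
  qed
  have "(\<integral>\<^sup>+ t. ennreal (pmf (VCG_allocation n m t) a) \<partial>PiM I M) =
      (\<integral>\<^sup>+ t. ennreal (pmf (VCG_allocation n m t) a)
        \<partial>distr (PiM I M) (PiM I M) (\<lambda>t. \<lambda>x\<in>I. t (f x)))"
    by (simp add: P)
  also have "\<dots> = (\<integral>\<^sup>+ t. ennreal (pmf (VCG_allocation n m (\<lambda>x\<in>I. t (f x))) a) \<partial>PiM I M)"
    using measurable_pmf_VCG_allocation[of D, OF D(2) n a]
    by (intro nn_integral_distr meas) (simp add: law)
  finally show ?thesis by (simp add: swap law)
qed

text \<open>All allocations in \<open>A\<close> have the same averaged mass, and these masses sum to
  1. Uniform tie-breaking keeps the symmetry even on instances with ties.\<close>

lemma nn_integral_emeasure_VCG_allocation: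
  assumes D: "\<And>j. prob_space (D j)" "\<And>j. sets (D j) = sets borel" and n: "1 \<le> n"
  shows "(\<integral>\<^sup>+ t. emeasure (VCG_allocation n m t) S \<partial>instance_law n m D) =
    emeasure (random_allocation {1..m} {1..n}) S"
proof -
  let ?P = "instance_law n m D"
  define A where "A = PiE_dflt {1..m} undefined (\<lambda>_. {1..n})"
  define w where "w a = (\<integral>\<^sup>+ t. ennreal (pmf (VCG_allocation n m t) a) \<partial>?P)" for a
  interpret prob_space ?P using D by (intro prob_space_instance_law)
  have A: "finite A" "A \<noteq> {}"
    using n by (auto simp: A_def PiE_dflt_empty_iff intro!: finite_PiE_dflt)
  have sum_w: "(\<integral>\<^sup>+ t. emeasure (VCG_allocation n m t) S \<partial>?P) = (\<Sum>a\<in>A \<inter> S. w a)" for S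
    using measurable_pmf_VCG_allocation[of D, OF D(2) n]
    unfolding w_def A_def emeasure_VCG_allocation[OF n]
    by (intro nn_integral_sum measurable_compose[OF _ measurable_ennreal]) auto
  obtain a0 where a0: "a0 \<in> A" using A by auto
  have w: "w a = w a0" if "a \<in> A" for a
    unfolding w_def using that a0 D n
    by (intro nn_integral_pmf_VCG_allocation_eq) (auto simp: A_def)
  have "of_nat (card A) * w a0 = 1"
    using sum_w[of UNIV] w by (simp add: measure_pmf.emeasure_space_1[simplified] emeasure_space_1)
  then have "w a0 = 1 / of_nat (card A)"
    using A mult_divide_eq_ennreal[of "of_nat (card A)" "w a0"]
    by (simp add: mult.commute)
  then have "(\<Sum>a\<in>A \<inter> S. w a) = of_nat (card (A \<inter> S)) / of_nat (card A)"
    using w by (simp add: ennreal_times_divide)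
  also have "\<dots> = emeasure (pmf_of_set A) S"
    using A by (simp add: emeasure_pmf_of_set ennreal_of_nat_eq_real_of_nat divide_ennreal card_gt_0_iff)
  also have "pmf_of_set A = random_allocation {1..m} {1..n}"
    unfolding A_def using n by (intro random_allocation_eq_pmf_of_set[symmetric]) auto
  finally show ?thesis by (simp add: sum_w)
qed

subsection \<open>Uniform processing times\<close>

text \<open>The hazard rate is 0 before \<open>a\<close> and then 1/(b - x), increasing up to
  \<open>b\<close>.\<close>

lemma MHR_distribution_uniform:
  fixes a b :: real
  assumes "a < b"
  shows "MHR_distribution (uniform_measure lborel {a..b})"
proof -
  let ?D = "uniform_measure lborel {a..b}"
  define f where "f x = indicator {a..b} x / (b - a)" for x :: real
  have prob: "prob_space ?D"
    using assms by (intro prob_space_uniform_measure) auto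
  interpret real_distribution ?D
    using prob by (simp add: real_distribution_def real_distribution_axioms_def)
  have "?D = density lborel (\<lambda>x. ennreal (f x))"
    using assms by (auto simp: uniform_measure_def f_def divide_ennreal ennreal_indicator[symmetric])
  moreover have "f \<in> borel_measurable borel" unfolding f_def by measurable
  moreover have f: "0 \<le> f x" for x using assms by (simp add: f_def)
  moreover have "mono_on {x. cdf ?D x < 1} (\<lambda>x. f x / (1 - cdf ?D x))"
  proof (rule mono_onI)
    fix x y assume xy: "x \<in> {x. cdf ?D x < 1}" "y \<in> {x. cdf ?D x < 1}" "x \<le> y"
    show "f x / (1 - cdf ?D x) \<le> f y / (1 - cdf ?D y)"
    proof (cases "a \<le> x")
      case True
      \<comment> \<open>All mass lies up to \<open>b\<close>, so the condition on the cdf forces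
        \<open>y < b\<close>, where the density still has its constant value.\<close>
      have "AE z in ?D. z \<le> b"
        using assms by (subst AE_uniform_measure) auto
      then have "prob {..b} = 1"
        by (subst prob_eq_1) auto
      then have "y < b"
        using xy(2) cdf_nondecreasing[of b y] by (force simp: cdf_def)
      then have "f x = f y" using True xy by (simp add: f_def)
      then show ?thesis
        using xy cdf_nondecreasing[of x y] f by (auto intro!: divide_left_mono)
    next
      case False
      then have "f x = 0" by (simp add: f_def)
      then show ?thesis using xy f[of y] by (simp add: divide_nonneg_pos)
    qed
  qed
  ultimately show ?thesis
    using prob unfolding MHR_distribution_def by blast
qed

lemma AE_uniform_measure_interval:
  fixes a b :: real
  assumes "a < b"
  shows "AE x in uniform_measure lborel {a..b}. a \<le> x \<and> x \<le> b"
  using assms by (subst AE_uniform_measure) auto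

lemma AE_instance_law:
  assumes "\<And>j. prob_space (D j)" "\<And>j. AE x in D j. P j x"
  shows "AE t in instance_law n m D. \<forall>i\<in>{1..n}. \<forall>j\<in>{1..m}. P j (t (i, j))"
proof -
  have "AE t in instance_law n m D. P j (t (i, j))" if "i \<in> {1..n}" "j \<in> {1..m}" for i j
    unfolding instance_law_def
    using that assms AE_PiM_component[of "{1..n} \<times> {1..m}" "\<lambda>(i, j). D j" "(i, j)" "P j"]
    by (auto split: prod.splits)
  then show ?thesis
    by (intro AE_finite_allI) auto
qed

section \<open>Pointwise bounds on the makespan and on \<open>OPT\<close>\<close>

lemma makespan_le_iff:
  assumes "1 \<le> n"
  shows "makespan n m t a \<le> x \<longleftrightarrow> (\<forall>i\<in>{1..n}. (\<Sum>j | j \<in> {1..m} \<and> a j = i. t (i, j)) \<le> x)"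
  unfolding makespan_def using assms by (subst Max_le_iff) auto

lemma sum_le_makespan:
  assumes "i \<in> {1..n}"
  shows "(\<Sum>j | j \<in> {1..m} \<and> a j = i. t (i, j)) \<le> makespan n m t a"
  unfolding makespan_def using assms by (intro Max_ge) auto

lemma OPT_le_makespan:
  assumes "a \<in> {1..m} \<rightarrow>\<^sub>E {1..n}"
  shows "OPT n m t \<le> makespan n m t a"
  unfolding OPT_def using assms by (intro Min_le finite_imageI finite_PiE) auto

lemma le_OPT:
  assumes "1 \<le> n" "\<And>a. a \<in> {1..m} \<rightarrow>\<^sub>E {1..n} \<Longrightarrow> x \<le> makespan n m t a"
  shows "x \<le> OPT n m t"
proof -
  have "{1..m} \<rightarrow>\<^sub>E {1..n} \<noteq> {}"
    using assms(1) by (simp add: PiE_eq_empty_iff)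
  then show ?thesis
    unfolding OPT_def using assms by (subst Min_ge_iff) (auto intro!: finite_PiE)
qed

text \<open>Each of the first \<open>l\<close> tasks given to \<open>i\<close> costs at least 1.
  Used with \<open>l = n\<close> for VCG and with \<open>l = 1\<close> for
  \<open>OPT\<close>.\<close>

lemma load_le_makespan:
  assumes "\<And>j. j \<in> {1..m} \<Longrightarrow> 0 \<le> t (i, j)" "\<And>j. j \<in> {1..l} \<Longrightarrow> 1 \<le> t (i, j)"
    and "l \<le> m" "i \<in> {1..n}"
  shows "real (load {1..l} a i) \<le> makespan n m t a"
proof -
  have "real (load {1..l} a i) = (\<Sum>j | j \<in> {1..l} \<and> a j = i. 1)"
    by (simp add: load_def)
  also have "\<dots> \<le> (\<Sum>j | j \<in> {1..l} \<and> a j = i. t (i, j))"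
    using assms by (intro sum_mono) auto
  also have "\<dots> \<le> (\<Sum>j | j \<in> {1..m} \<and> a j = i. t (i, j))"
    using assms by (intro sum_mono2) auto
  also have "\<dots> \<le> makespan n m t a"
    using assms by (intro sum_le_makespan)
  finally show ?thesis .
qed

lemma OPT_ge_1:
  assumes "\<And>i j. i \<in> {1..n} \<Longrightarrow> j \<in> {1..m} \<Longrightarrow> 0 \<le> t (i, j)"
    and "\<And>i. i \<in> {1..n} \<Longrightarrow> 1 \<le> t (i, 1)" and "1 \<le> n" "1 \<le> m"
  shows "1 \<le> OPT n m t"
proof (rule le_OPT)
  fix a assume "a \<in> {1..m} \<rightarrow>\<^sub>E {1..n}"
  then have a: "a 1 \<in> {1..n}" using assms by (auto simp: PiE_def Pi_def)
  have "real (load {1..1} a (a 1)) \<le> makespan n m t a"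
    using assms a by (intro load_le_makespan) auto
  moreover have "{x \<in> {1..1::nat}. a x = a 1} = {1}" by auto
  ultimately show "1 \<le> makespan n m t a" by (simp add: load_def)
qed (fact assms)

lemma OPT_le_3:
  assumes "\<And>i j. i \<in> {1..n} \<Longrightarrow> j \<in> {1..n} \<Longrightarrow> 0 \<le> t (i, j) \<and> t (i, j) \<le> 2"
    and "\<And>i j. i \<in> {1..n} \<Longrightarrow> j \<in> {n<..m} \<Longrightarrow> 0 \<le> t (i, j) \<and> t (i, j) \<le> 1 / real m"
    and "1 \<le> n" "n \<le> m"
  shows "OPT n m t \<le> 3"
proof -
  \<comment> \<open>Long task \<open>j\<close> goes to machine \<open>j\<close> and all short tasks
    go to machine 1.\<close>
  define a where "a = (\<lambda>j\<in>{1..m}. if j \<le> n then j else 1)"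
  have "OPT n m t \<le> makespan n m t a"
    using assms by (intro OPT_le_makespan) (auto simp: a_def)
  also have "makespan n m t a \<le> 3"
    unfolding makespan_le_iff[OF assms(3)]
  proof
    fix i assume i: "i \<in> {1..n}"
    \<comment> \<open>Charging every machine with all short tasks, of total at most 1, avoids
      treating machine 1 separately.\<close>
    have "(\<Sum>j | j \<in> {1..m} \<and> a j = i. t (i, j)) \<le> (\<Sum>j\<in>{i} \<union> {n<..m}. t (i, j))"
      using i assms by (intro sum_mono2) (auto simp: a_def split: if_splits)
    also have "\<dots> = t (i, i) + (\<Sum>j\<in>{n<..m}. t (i, j))"
      using i by (subst sum.union_disjoint) auto
    also have "\<dots> \<le> 2 + (\<Sum>j\<in>{n<..m}. 1 / real m)"
      using i assms by (intro add_mono sum_mono) auto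
    also have "\<dots> \<le> 3"
      using assms by (simp add: divide_simps)
    finally show "(\<Sum>j | j \<in> {1..m} \<and> a j = i. t (i, j)) \<le> 3" .
  qed
  finally show ?thesis .
qed

text \<open>Restricted to the first \<open>n\<close> tasks, the random allocation is again
  independent and uniform, now with as many balls as bins.\<close>

lemma prob_max_load_subset_ge:
  assumes "2 \<le> n" "n \<le> m" "1 \<le> k" "3 * k ^ k \<le> n"
  shows "1 / 2 \<le> measure_pmf.prob (random_allocation {1..m} {1..n})
    {a. \<exists>i\<in>{1..n}. k \<le> load {1..n} a i}"
proof -
  let ?r = "\<lambda>a x. if x \<in> {1..n} then a x else undefined"
  have "load {1..n} (?r a) i = load {1..n} a i" for a :: "nat \<Rightarrow> nat" and i
    by (auto simp: load_def intro!: arg_cong[where f = card])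
  moreover have "random_allocation {1..n} {1..n} = map_pmf ?r (random_allocation {1..m} {1..n})"
    unfolding random_allocation_def using assms by (intro Pi_pmf_subset) auto
  ultimately show ?thesis
    using prob_max_load_ge[of "{1..n}" "{1..n}" n k] assms
    by (simp add: vimage_def del: One_nat_def)
qed

subsection \<open>The lower bound\<close>

lemma exists_load_bound:
  "\<exists>c::real. c > 0 \<and> (\<forall>n\<ge>3. \<exists>k::nat. 1 \<le> k \<and> 3 * k ^ k \<le> n \<and>
     c * (ln (real n) / ln (ln (real n))) \<le> real k / 6)"
proof -
  have e3: "exp 1 < (3::real)" using e_less_272 by simp
  then have l3: "1 < ln (3::real)"
    by (metis exp_gt_zero ln_exp ln_less_cancel_iff zero_less_numeral)
  then have ll3: "0 < ln (ln (3::real))" by (rule ln_gt_zero)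
  \<comment> \<open>For large \<open>n\<close>, \<open>k\<close> is at least a quarter of the ratio
    of logarithms, whence 1/24. Below 27 that ratio is at most ln 27 / ln ln 3, so the second term
    makes \<open>k = 1\<close> enough.\<close>
  define c where "c = min (1 / 24) (ln (ln 3) / (6 * ln (27::real)))"
  have c: "0 < c" using ll3 by (simp add: c_def)
  have "\<exists>k::nat. 1 \<le> k \<and> 3 * k ^ k \<le> n \<and> c * (ln (real n) / ln (ln (real n))) \<le> real k / 6"
    if n: "n \<ge> 3" for n
  proof (cases "n < 27")
    case True
    have "ln 3 \<le> ln (real n)" using n by simp
    then have "1 \<le> ln (real n)" using l3 by linarith
    have "ln (ln 3) \<le> ln (ln (real n))"
      using ll3 n by (subst ln_le_cancel_iff) auto
    then have "ln (real n) / ln (ln (real n)) \<le> ln 27 / ln (ln 3)"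
      using True n ll3 by (intro frac_le) auto
    then have "c * (ln (real n) / ln (ln (real n))) \<le>
        (ln (ln 3) / (6 * ln (27::real))) * (ln 27 / ln (ln 3))"
      using c ll3 \<open>1 \<le> ln (real n)\<close>
      by (intro mult_mono divide_nonneg_nonneg) (auto simp: c_def)
    also have "\<dots> = 1 / 6" using ll3 by simp
    finally show ?thesis using n by (intro exI[of _ 1]) auto
  next
    case False
    define x where "x = ln (real n)"
    define y where "y = ln x"
    define L where "L = x / y"
    define k where "k = nat \<lfloor>L / 2\<rfloor>"
    \<comment> \<open>The threshold 27 exceeds e^3, so x \<ge> 3 > e and y \<ge> 1.\<close>
    have "exp (real 3 * 1) \<le> (3::real) ^ 3"
      unfolding exp_of_nat_mult using e3 by (intro power_mono) auto
    then have "exp 3 \<le> real n" using False by simp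
    then have x: "3 \<le> x" using n by (simp add: x_def ln_ge_iff)
    then have y: "1 \<le> y" using e3 by (simp add: y_def ln_ge_iff)
    \<comment> \<open>This gives y \<le> x/2, that is L \<ge> 2, so that rounding
      \<open>L / 2\<close> down leaves k \<ge> 1.\<close>
    have "y = ln (x / 2) + ln 2" using x by (simp add: y_def ln_div)
    also have "\<dots> \<le> (x / 2 - 1) + (2 - 1)"
      using x by (intro add_mono ln_le_minus_one) auto
    finally have L: "2 \<le> L" using y by (simp add: L_def field_simps)
    have "L \<le> x" using x y by (simp add: L_def field_simps)
    have k1: "1 \<le> k" using L by (simp add: k_def le_nat_iff le_floor_iff)
    have k_le: "real k \<le> L / 2" using L of_int_floor_le[of "L / 2"] by (simp add: k_def)
    have "L / 2 < real k + 1" using L by (simp add: k_def)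
    then have k_ge: "L / 4 \<le> real k" using k1 by simp
    have "ln (real k) \<le> y"
      unfolding y_def using k1 k_le \<open>L \<le> x\<close> L by (subst ln_le_cancel_iff) auto
    then have "real k * ln (real k) \<le> (L / 2) * y"
      using k_le k1 L by (intro mult_mono) auto
    also have "\<dots> = x / 2" using y by (simp add: L_def)
    finally have kx: "real k * ln (real k) \<le> x / 2" .
    have "real k ^ k = exp (real k * ln (real k))"
      using k1 by (simp add: exp_of_nat_mult)
    also have "\<dots> \<le> exp (x / 2)" using kx by simp
    also have "\<dots> = sqrt (real n)"
      using n by (simp add: x_def powr_def flip: powr_half_sqrt)
    \<comment> \<open>Since n \<ge> 27, one factor sqrt n absorbs the 3 and the other bounds
      k^k.\<close>
    finally have "3 * real k ^ k \<le> sqrt (real n) * sqrt (real n)"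
      using False by (intro mult_mono) (auto intro!: real_le_rsqrt)
    then have "real (3 * k ^ k) \<le> real n" by simp
    then have "3 * k ^ k \<le> n" by (simp only: of_nat_le_iff)
    moreover have "c * L \<le> real k / 6"
    proof -
      have "c * L \<le> 1 / 24 * L" using L by (intro mult_right_mono) (auto simp: c_def)
      then show ?thesis using k_ge by simp
    qed
    ultimately show ?thesis using k1 by (auto simp: L_def x_def y_def)
  qed
  with c show ?thesis by blast
qed

text \<open>The 6 combines probability at least 1/2 of makespan at least \<open>k\<close> with
  \<open>OPT\<close> at most 3.\<close>

lemma VCG_OPT_ratio_ge:
  assumes "2 \<le> n" "n \<le> m" "1 \<le> k" "3 * k ^ k \<le> n"
  defines "D \<equiv> \<lambda>j. uniform_measure lborel (if j \<le> n then {1..2} else {0..1 / real m})"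
  shows "\<forall>j. MHR_distribution (D j) \<and> (AE x in D j. 0 \<le> x)"
    and "0 < E_OPT n m D" and "E_OPT n m D < \<infinity>"
    and "ennreal (real k / 6) \<le> E_VCG n m D / E_OPT n m D"
proof -
  let ?P = "instance_law n m D"
  have m: "0 < m" using assms by simp
  define good where "good j x \<longleftrightarrow> (if j \<le> n then 1 \<le> x \<and> x \<le> 2 else 0 \<le> x \<and> x \<le> 1 / real m)"
    for j and x :: real
  have AE_good: "AE x in D j. good j x" for j
    using AE_uniform_measure_interval[of 1 2] AE_uniform_measure_interval[of 0 "1 / real m"] m
    unfolding D_def good_def by (cases "j \<le> n") simp_all
  have nonneg: "0 \<le> x" if "good j x" for j x
    using that by (auto simp: good_def split: if_splits)
  have ge_1: "1 \<le> x" and le_2: "x \<le> 2" if "good j x" "j \<le> n" for j x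
    using that by (simp_all add: good_def)
  have le_inverse: "x \<le> 1 / real m" if "good j x" "n < j" for j x
    using that by (simp add: good_def)
  show mhr: "\<forall>j. MHR_distribution (D j) \<and> (AE x in D j. 0 \<le> x)"
  proof (intro allI conjI)
    fix j
    show "MHR_distribution (D j)"
      using m by (auto simp: D_def intro!: MHR_distribution_uniform)
    show "AE x in D j. 0 \<le> x"
      using AE_good by (rule eventually_mono) (rule nonneg)
  qed
  have D: "\<And>j. prob_space (D j)" "\<And>j. sets (D j) = sets borel"
    using mhr by (auto simp: MHR_distribution_def D_def)
  interpret prob_space ?P using D by (intro prob_space_instance_law)
  from D AE_good have AE: "AE t in ?P. \<forall>i\<in>{1..n}. \<forall>j\<in>{1..m}. good j (t (i, j))"
    by (intro AE_instance_law) auto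
  have "AE t in ?P. 1 \<le> ennreal (OPT n m t)"
    using AE
  proof eventually_elim
    case (elim t)
    have good: "good j (t (i, j))" if "i \<in> {1..n}" "j \<in> {1..m}" for i j
      using elim that by blast
    have "1 \<le> OPT n m t"
      using assms(1,2) by (intro OPT_ge_1 nonneg[OF good] ge_1[OF good]) auto
    then show ?case by simp
  qed
  then have "(\<integral>\<^sup>+ t. 1 \<partial>?P) \<le> E_OPT n m D"
    unfolding E_OPT_def by (intro nn_integral_mono_AE)
  then have "1 \<le> E_OPT n m D" by (simp add: emeasure_space_1)
  then show pos: "0 < E_OPT n m D" by (rule less_le_trans[rotated]) simp
  have "AE t in ?P. ennreal (OPT n m t) \<le> 3"
    using AE
  proof eventually_elim
    case (elim t)
    have good: "good j (t (i, j))" if "i \<in> {1..n}" "j \<in> {1..m}" for i j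
      using elim that by blast
    have "OPT n m t \<le> 3"
      using assms(1,2)
      by (intro OPT_le_3 conjI nonneg[OF good] le_2[OF good] le_inverse[OF good]) auto
    then show ?case by (metis ennreal_leI ennreal_numeral zero_le_numeral)
  qed
  then have "E_OPT n m D \<le> (\<integral>\<^sup>+ t. 3 \<partial>?P)"
    unfolding E_OPT_def by (intro nn_integral_mono_AE)
  then have le3: "E_OPT n m D \<le> 3" by (simp add: emeasure_space_1)
  also have "3 < (\<infinity>::ennreal)" by simp
  finally show fin: "E_OPT n m D < \<infinity>" .
  define S where "S = {a. \<exists>i\<in>{1..n}. k \<le> load {1..n} a i}"
  have "ennreal (real k / 2) = ennreal (real k) * ennreal (1 / 2)"
    by (subst ennreal_mult[symmetric]) auto
  also have "\<dots> \<le> ennreal (real k) * emeasure (random_allocation {1..m} {1..n}) S"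
    unfolding measure_pmf.emeasure_eq_measure S_def
    using assms by (intro mult_left_mono ennreal_leI prob_max_load_subset_ge) auto
  \<comment> \<open>Averaged over instances, VCG is a uniform random allocation, so the
    balls-into-bins bound applies to it.\<close>
  also have "\<dots> = ennreal (real k) * (\<integral>\<^sup>+ t. emeasure (VCG_allocation n m t) S \<partial>?P)"
    using assms D by (subst nn_integral_emeasure_VCG_allocation) auto
  also have "\<dots> = (\<integral>\<^sup>+ t. ennreal (real k) * emeasure (VCG_allocation n m t) S \<partial>?P)"
    using assms D by (intro nn_integral_cmult[symmetric] measurable_emeasure_VCG_allocation) auto
  also have "\<dots> \<le> E_VCG n m D"
    unfolding E_VCG_def
  proof (rule nn_integral_mono_AE, use AE in eventually_elim)
    case (elim t)
    have "ennreal (real k) * emeasure (VCG_allocation n m t) S =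
        (\<integral>\<^sup>+ a. ennreal (real k) * indicator S a \<partial>VCG_allocation n m t)"
      by (simp add: nn_integral_cmult)
    also have "\<dots> \<le> (\<integral>\<^sup>+ a. ennreal (makespan n m t a) \<partial>VCG_allocation n m t)"
    proof (rule nn_integral_mono)
      fix a
      show "ennreal (real k) * indicator S a \<le> ennreal (makespan n m t a)"
      proof (cases "a \<in> S")
        case True
        then obtain i where i: "i \<in> {1..n}" "k \<le> load {1..n} a i" by (auto simp: S_def)
        have good: "good j (t (i, j))" if "j \<in> {1..m}" for j
          using elim i that by blast
        have "real (load {1..n} a i) \<le> makespan n m t a"
          using i assms(2) by (intro load_le_makespan nonneg[OF good] ge_1[OF good]) auto
        then show ?thesis using True i by (auto intro!: ennreal_leI)
      qed simp
    qed
    finally show ?case .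
  qed
  finally have k2: "ennreal (real k / 2) \<le> E_VCG n m D" .
  \<comment> \<open>Positivity and finiteness of \<open>E_OPT\<close> let the inverses be compared
    over the reals.\<close>
  obtain r where r: "E_OPT n m D = ennreal r" "0 \<le> r"
    using fin by (cases "E_OPT n m D") auto
  have "ennreal r \<le> ennreal 3" using le3 r by simp
  then have "r \<le> 3" by (subst (asm) ennreal_le_iff) auto
  have "0 < r" using pos r by simp
  with \<open>r \<le> 3\<close> have inv: "inverse (ennreal 3) \<le> inverse (E_OPT n m D)"
    by (simp only: r inverse_ennreal zero_less_numeral)
      (intro ennreal_leI le_imp_inverse_le)
  have "ennreal (real k / 2) / ennreal 3 \<le> E_VCG n m D / ennreal 3"
    using k2 by (rule divide_right_mono_ennreal)
  also have "\<dots> \<le> E_VCG n m D / E_OPT n m D"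
    unfolding divide_ennreal_def using inv by (rule mult_left_mono) simp
  also have "ennreal (real k / 2) / ennreal 3 = ennreal (real k / 6)"
    by (subst divide_ennreal) auto
  finally show "ennreal (real k / 6) \<le> E_VCG n m D / E_OPT n m D" .
qed

theorem theorem10:
  "\<exists>c::real. c > 0 \<and>
     (\<forall>n m :: nat. n \<ge> 3 \<longrightarrow> m \<ge> n \<longrightarrow>
        (\<exists>D :: nat \<Rightarrow> real measure.
           (\<forall>j\<in>{1..m}. MHR_distribution (D j) \<and> (AE x in D j. 0 \<le> x)) \<and>
           0 < E_OPT n m D \<and> E_OPT n m D < \<infinity> \<and>
           E_VCG n m D / E_OPT n m D \<ge> ennreal (c * (ln (real n) / ln (ln (real n))))))"
proof -
  obtain c :: real where c: "c > 0"
    and bound: "\<And>n. n \<ge> 3 \<Longrightarrow> \<exists>k::nat. 1 \<le> k \<and> 3 * k ^ k \<le> n \<and>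
      c * (ln (real n) / ln (ln (real n))) \<le> real k / 6"
    using exists_load_bound by blast
  show ?thesis
  proof (intro exI[of _ c] conjI allI impI)
    fix n m :: nat assume nm: "n \<ge> 3" "m \<ge> n"
    obtain k :: nat where k: "1 \<le> k" "3 * k ^ k \<le> n"
      and ck: "c * (ln (real n) / ln (ln (real n))) \<le> real k / 6"
      using bound[OF nm(1)] by blast
    have n: "2 \<le> n" using nm by simp
    let ?D = "\<lambda>j. uniform_measure lborel (if j \<le> n then {1..2} else {0..1 / real m})"
    note ratio = VCG_OPT_ratio_ge[OF n nm(2) k]
    show "\<exists>D :: nat \<Rightarrow> real measure.
           (\<forall>j\<in>{1..m}. MHR_distribution (D j) \<and> (AE x in D j. 0 \<le> x)) \<and>
           0 < E_OPT n m D \<and> E_OPT n m D < \<infinity> \<and>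
           E_VCG n m D / E_OPT n m D \<ge> ennreal (c * (ln (real n) / ln (ln (real n))))"
      using ratio order_trans[OF ennreal_leI[OF ck] ratio(4)] by (intro exI[of _ ?D]) simp
  qed (fact c)
qed

end
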